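(* For each of the following 2-dimensional non-commutative complex pre-Lie algebras $B_i$ with basis $\{e_1,e_2\}$ (products of basis elements not listed are zero), a linear map $N:B_i\to B_i$ is a Nijenhuis operator if and only if it is one of the maps listed for $B_i$. All $n_{ij}$ are arbitrary complex numbers subject only to the stated restrictions. (1) $B_1$: $e_2\cdot e_1=-e_1,\ e_2\cdot e_2=e_1-e_2$. Operators: - $N^1_{B_1}(e_1)=n_{11}e_1,\ N^1_{B_1}(e_2)=n_{21}e_1+n_{11}e_2$. (2) $B_2$: $e_2\cdot e_1=-e_1,\ e_2\cdot e_2=-e_2$. Operators: - $N^1_{B_2}(e_1)=n_{11}e_1+n_{12}e_2,\ N^1_{B_2}(e_2)=n_{21}e_1+n_{22}e_2$ (every linear map). (3) $B_3$: $e_2\cdot e_1=-e_1,\ e_2\cdot e_2=ke_2$, where $k\in\mathbb C$, $k\neq -1$ is fixed. Operators: - $N^1_{B_3}(e_1)=n_{11}e_1,\ N^1_{B_3}(e_2)=n_{21}e_1+n_{11}e_2$, $n_{21}\neq 0$; - $N^2_{B_3}(e_1)=n_{11}e_1,\ N^2_{B_3}(e_2)=n_{22}e_2$. (4) $B_4$: $e_1\cdot e_2=e_1,\ e_2\cdot e_2=e_2$. Operators: - $N^1_{B_4}(e_1)=n_{11}e_1+n_{12}e_2,\ N^1_{B_4}(e_2)=n_{21}e_1+n_{22}e_2$ (every linear map). (5) $B_5$: $e_1\cdot e_2=le_1,\ e_2\cdot e_1=(l-1)e_1,\ e_2\cdot e_2=e_1+le_2$, where $l\in\mathbb C$, $l\neq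 0$ is fixed. Operators: - $N^1_{B_5}(e_1)=n_{11}e_1,\ N^1_{B_5}(e_2)=n_{21}e_1+n_{11}e_2$; - (only when $l\neq 1$) $N^2_{B_5}(e_1)=n_{11}e_1,\ N^2_{B_5}(e_2)=\frac{n_{11}-n_{22}}{l-1}e_1+n_{22}e_2$, $n_{11}\neq n_{22}$. (6) $B_6$: $e_1\cdot e_1=2e_1,\ e_1\cdot e_2=e_2,\ e_2\cdot e_2=e_1$. Operators: - $N^1_{B_6}(e_1)=n_{11}e_1,\ N^1_{B_6}(e_2)=n_{21}e_1+(n_{11}\pm n_{21}\sqrt{-1})e_2$ (either sign); - $N^2_{B_6}(e_1)=n_{11}e_1+n_{12}e_2,\ N^2_{B_6}(e_2)=-n_{12}e_1+n_{11}e_2$, $n_{12}\neq 0$.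
   Context: A (complex) pre-Lie algebra is a complex vector space $A$ with a bilinear product $\cdot$ satisfying $(x\cdot y)\cdot z-x\cdot(y\cdot z)=(y\cdot x)\cdot z-y\cdot(x\cdot z)$ for all $x,y,z\in A$. A Nijenhuis operator on $(A,\cdot)$ is a linear map $N:A\to A$ such that $N(x)\cdot N(y)=N\big(N(x)\cdot y+x\cdot N(y)-N(x\cdot y)\big)$ for all $x,y\in A$. *)

theory Defs
  imports Complex_Main
begin

definition bilinear_product ::
    "(complex \<Rightarrow> 'a \<Rightarrow> 'a) \<Rightarrow> ('a::ab_group_add \<Rightarrow> 'a \<Rightarrow> 'a) \<Rightarrow> bool" where
  "bilinear_product scale mult \<longleftrightarrow>
     (\<forall>x. Vector_Spaces.linear scale scale (\<lambda>y. mult x y)) \<and>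
     (\<forall>y. Vector_Spaces.linear scale scale (\<lambda>x. mult x y))"

definition pre_lie_algebra ::
    "(complex \<Rightarrow> 'a \<Rightarrow> 'a) \<Rightarrow> ('a::ab_group_add \<Rightarrow> 'a \<Rightarrow> 'a) \<Rightarrow> bool" where
  "pre_lie_algebra scale mult \<longleftrightarrow>
     vector_space scale \<and> bilinear_product scale mult \<and>
     (\<forall>x y z. mult (mult x y) z - mult x (mult y z) = mult (mult y x) z - mult y (mult x z))"

definition non_commutative :: "('a \<Rightarrow> 'a \<Rightarrow> 'a) \<Rightarrow> bool" where
  "non_commutative mult \<longleftrightarrow> (\<exists>x y. mult x y \<noteq> mult y x)"

definition nijenhuis_operator ::
    "(complex \<Rightarrow> 'a \<Rightarrow> 'a) \<Rightarrow> ('a::ab_group_add \<Rightarrow> 'a \<Rightarrow> 'a) \<Rightarrow> ('a \<Rightarrow> 'a) \<Rightarrow> bool" where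
  "nijenhuis_operator scale mult N \<longleftrightarrow>
     Vector_Spaces.linear scale scale N \<and>
     (\<forall>x y. mult (N x) (N y) = N (mult (N x) y + mult x (N y) - N (mult x y)))"

text \<open>Distinctness is required separately: the set \<open>{e1, e2}\<close> collapses when \<open>e1 = e2\<close>.\<close>

definition two_dim_basis ::
    "(complex \<Rightarrow> 'a \<Rightarrow> 'a) \<Rightarrow> 'a::ab_group_add \<Rightarrow> 'a \<Rightarrow> bool" where
  "two_dim_basis scale e1 e2 \<longleftrightarrow>
     e1 \<noteq> e2 \<and> \<not> module.dependent scale {e1, e2} \<and> module.span scale {e1, e2} = UNIV"

text \<open>The values are listed in the order of the products 11, 12, 21, 22.\<close>

definition product_table ::
    "('a \<Rightarrow> 'a \<Rightarrow> 'a) \<Rightarrow> 'a \<Rightarrow> 'a \<Rightarrow> 'a \<Rightarrow> 'a \<Rightarrow> 'a \<Rightarrow> 'a \<Rightarrow> bool" where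
  "product_table mult e1 e2 p11 p12 p21 p22 \<longleftrightarrow>
     mult e1 e1 = p11 \<and> mult e1 e2 = p12 \<and> mult e2 e1 = p21 \<and> mult e2 e2 = p22"

end

theory Submission
  imports Defs
begin

text \<open>
  Both sides of the Nijenhuis identity are bilinear, so it suffices to check it on pairs of basis
  vectors, where it becomes a system of quadratic equations in the matrix entries of \<open>N\<close>.
  For \<open>B\<^sub>1\<close>, \<open>B\<^sub>3\<close> and \<open>B\<^sub>5\<close> the pair \<open>(e1, e1)\<close> forces \<open>e1\<close> to be an eigenvector, and the pair
  \<open>(e2, e2)\<close> then gives a single factorising equation; for \<open>B\<^sub>6\<close> the pair \<open>(e1, e1)\<close> separates the
  two families.
\<close>

section \<open>Coordinates in a two-dimensional algebra\<close>

locale plane_algebra = vector_space scale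
  for scale :: "complex \<Rightarrow> 'a::ab_group_add \<Rightarrow> 'a" (infixr "*s" 75) +
  fixes mult :: "'a \<Rightarrow> 'a \<Rightarrow> 'a" and e1 e2 :: 'a
  assumes basis: "two_dim_basis scale e1 e2"
    and bilinear: "bilinear_product scale mult"
begin

definition vec :: "complex \<Rightarrow> complex \<Rightarrow> 'a" where
  "vec u v = u *s e1 + v *s e2"

lemma vec_basis: "vec 1 0 = e1" "vec 0 1 = e2"
  by (simp_all add: vec_def)

lemma vec_add: "vec u v + vec u' v' = vec (u + u') (v + v')"
  by (simp add: vec_def scale_left_distrib)

lemma vec_diff: "vec u v - vec u' v' = vec (u - u') (v - v')"
  by (simp add: vec_def scale_left_diff_distrib)

lemma vec_minus: "- vec u v = vec (- u) (- v)"
  by (simp add: vec_def)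

lemma vec_scale: "c *s vec u v = vec (c * u) (c * v)"
  by (simp add: vec_def scale_right_distrib)

lemmas vec_arith = vec_add vec_diff vec_minus vec_scale

lemma vec_eq_0_iff: "vec u v = 0 \<longleftrightarrow> u = 0 \<and> v = 0"
proof
  assume eq: "vec u v = 0"
  have ind: "independent {e1, e2}" and ne: "e1 \<noteq> e2"
    using basis by (auto simp: two_dim_basis_def)
  \<comment> \<open>Linear independence speaks of a coefficient function on a set. Distinctness of
    \<open>e1\<close> and \<open>e2\<close> makes the sum have two terms and lets one function carry
    both coordinates.\<close>
  have "(\<Sum>x\<in>{e1, e2}. (if x = e1 then u else v) *s x) = 0"
    using ne eq by (simp add: vec_def)
  then have "\<forall>x\<in>{e1, e2}. (if x = e1 then u else v) = 0"
    using independentD[OF ind, of "{e1, e2}" "\<lambda>x. if x = e1 then u else v"] by blast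
  then show "u = 0 \<and> v = 0"
    using ne by auto
qed (simp add: vec_def)

lemma vec_eq_iff: "vec u v = vec u' v' \<longleftrightarrow> u = u' \<and> v = v'"
  using vec_eq_0_iff[of "u - u'" "v - v'"] by (simp flip: vec_diff)

lemma vec_cases:
  obtains u v where "x = vec u v"
proof -
  have "x \<in> span {e1, e2}"
    using basis by (simp add: two_dim_basis_def)
  \<comment> \<open>Peeling \<open>e1\<close> and then \<open>e2\<close> off the spanning set leaves
    a remainder in the span of the empty set, which is 0.\<close>
  then obtain u v where "x - u *s e1 = v *s e2"
    by (auto simp: span_breakdown_eq)
  then have "x = vec u v"
    by (simp add: vec_def algebra_simps)
  then show thesis ..
qed

lemma linear_mult_right: "Vector_Spaces.linear scale scale (\<lambda>y. mult x y)"
  and linear_mult_left: "Vector_Spaces.linear scale scale (\<lambda>x. mult x y)"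
  using bilinear by (auto simp: bilinear_product_def)

lemma linear_vec:
  assumes "Vector_Spaces.linear scale scale f"
  shows "f (vec u v) = u *s f e1 + v *s f e2"
  using assms by (simp add: vec_def Vector_Spaces.linear_iff)

text \<open>Here \<open>p\<close> holds the \<open>e1\<close>-coordinates of the table and
  \<open>q\<close> the \<open>e2\<close>-coordinates. Together with \<open>vec_eq_iff\<close> this
  turns identities between products into polynomial identities between complex numbers.\<close>

lemma mult_vec:
  assumes "product_table mult e1 e2 (vec p11 q11) (vec p12 q12) (vec p21 q21) (vec p22 q22)"
  shows "mult (vec x1 x2) (vec y1 y2) =
    vec (p11 * (x1 * y1) + p12 * (x1 * y2) + p21 * (x2 * y1) + p22 * (x2 * y2))
      (q11 * (x1 * y1) + q12 * (x1 * y2) + q21 * (x2 * y1) + q22 * (x2 * y2))"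
proof -
  have "mult (vec x1 x2) (vec y1 y2) =
    (x1 * y1) *s mult e1 e1 + (x1 * y2) *s mult e1 e2 +
    (x2 * y1) *s mult e2 e1 + (x2 * y2) *s mult e2 e2"
    by (simp add: linear_vec[OF linear_mult_left] linear_vec[OF linear_mult_right]
        scale_right_distrib ac_simps)
  then show ?thesis
    using assms by (simp add: product_table_def vec_arith mult.commute)
qed

section \<open>Reduction of multilinear identities to basis vectors\<close>

lemma linear_on_basis:
  assumes "Vector_Spaces.linear scale scale f" "Vector_Spaces.linear scale scale g"
    and "f e1 = g e1" "f e2 = g e2"
  shows "f x = g x"
  using assms by (cases x rule: vec_cases) (simp add: linear_vec)

text \<open>The pre-Lie identity says that the associator is symmetric in its first two arguments.
  The associator is trilinear, and symmetry is trivial when these arguments agree, so only the pair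
  \<open>e1\<close>, \<open>e2\<close> has to be tested.\<close>

lemma pre_lie_on_basis:
  assumes "\<And>z. z \<in> {e1, e2} \<Longrightarrow>
    mult (mult e1 e2) z - mult e1 (mult e2 z) = mult (mult e2 e1) z - mult e2 (mult e1 z)"
  shows "pre_lie_algebra scale mult"
proof -
  have lin: "Vector_Spaces.linear scale scale (\<lambda>z. mult (mult x y) z - mult x (mult y z))"
    "Vector_Spaces.linear scale scale (\<lambda>x. mult (mult x y) z - mult x (mult y z))"
    "Vector_Spaces.linear scale scale (\<lambda>y. mult (mult x y) z - mult x (mult y z))" for x y z
    using bilinear unfolding bilinear_product_def Vector_Spaces.linear_iff
    by (simp_all add: scale_right_diff_distrib)
  \<comment> \<open>The extension runs over one argument at a time: first \<open>z\<close>, then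
    \<open>y\<close>, then \<open>x\<close>. In the last two steps the two sides are the same
    associator with linearity used in different slots, hence the crossed use of
    \<open>lin(2)\<close> and \<open>lin(3)\<close>.\<close>
  have e: "mult (mult e1 e2) z - mult e1 (mult e2 z) = mult (mult e2 e1) z - mult e2 (mult e1 z)"
    for z
    by (rule linear_on_basis[OF lin(1) lin(1)]) (simp_all add: assms)
  have "mult (mult e1 y) z - mult e1 (mult y z) = mult (mult y e1) z - mult y (mult e1 z)"
    and "mult (mult e2 y) z - mult e2 (mult y z) = mult (mult y e2) z - mult y (mult e2 z)" for y z
    by (rule linear_on_basis[OF lin(3) lin(2)]; simp add: e)+
  then have "mult (mult x y) z - mult x (mult y z) = mult (mult y x) z - mult y (mult x z)" for x y z
    by (rule linear_on_basis[OF lin(2) lin(3)])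
  then show ?thesis
    using bilinear vector_space_axioms by (simp add: pre_lie_algebra_def)
qed

lemma nijenhuis_on_basis:
  assumes "Vector_Spaces.linear scale scale N"
  shows "nijenhuis_operator scale mult N \<longleftrightarrow>
    (\<forall>x\<in>{e1, e2}. \<forall>y\<in>{e1, e2}.
      mult (N x) (N y) = N (mult (N x) y + mult x (N y) - N (mult x y)))" (is "_ \<longleftrightarrow> ?R")
proof
  assume R: ?R
  have lin: "Vector_Spaces.linear scale scale (\<lambda>x. mult (N x) (N y))"
    "Vector_Spaces.linear scale scale (\<lambda>y. mult (N x) (N y))"
    "Vector_Spaces.linear scale scale (\<lambda>x. N (mult (N x) y + mult x (N y) - N (mult x y)))"
    "Vector_Spaces.linear scale scale (\<lambda>y. N (mult (N x) y + mult x (N y) - N (mult x y)))" for x y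
    \<comment> \<open>\<open>linear_iff\<close> provides additivity and homogeneity; the difference
      inside \<open>N\<close> is split by \<open>module_hom.diff\<close>.\<close>
    using bilinear assms module_hom.diff[OF module_hom_linearI[OF assms]]
    unfolding bilinear_product_def Vector_Spaces.linear_iff
    by (simp_all add: scale_right_distrib scale_right_diff_distrib)
  have "mult (N e1) (N y) = N (mult (N e1) y + mult e1 (N y) - N (mult e1 y))"
    and "mult (N e2) (N y) = N (mult (N e2) y + mult e2 (N y) - N (mult e2 y))" for y
    by (rule linear_on_basis[OF lin(2) lin(4)]; use R in simp)+
  then have "mult (N x) (N y) = N (mult (N x) y + mult x (N y) - N (mult x y))" for x y
    by (rule linear_on_basis[OF lin(1) lin(3)])
  with assms show "nijenhuis_operator scale mult N"
    by (simp add: nijenhuis_operator_def)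
qed (simp add: nijenhuis_operator_def)

section \<open>The defining conditions in coordinates\<close>

lemma pre_lie_vec:
  assumes tab: "product_table mult e1 e2 (vec p11 q11) (vec p12 q12) (vec p21 q21) (vec p22 q22)"
    and "\<And>z. z \<in> {vec 1 0, vec 0 1} \<Longrightarrow>
      mult (vec p12 q12) z - mult (vec 1 0) (mult (vec 0 1) z) =
      mult (vec p21 q21) z - mult (vec 0 1) (mult (vec 1 0) z)"
  shows "pre_lie_algebra scale mult"
  using assms by (intro pre_lie_on_basis) (simp add: vec_basis product_table_def)

lemma non_commutative_vec:
  assumes "product_table mult e1 e2 p11 (vec p12 q12) (vec p21 q21) p22"
    and "p12 \<noteq> p21 \<or> q12 \<noteq> q21"
  shows "non_commutative mult"
  using assms unfolding non_commutative_def product_table_def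
  by (intro exI[of _ e1] exI[of _ e2]) (simp add: vec_eq_iff)

text \<open>The images of \<open>e1\<close> and \<open>e2\<close> are the rows of the matrix of
  \<open>N\<close>, which acts on row vectors. Writing the basis as \<open>vec 1 0\<close> and
  \<open>vec 0 1\<close> lets \<open>mult_vec\<close> evaluate every product in the basis
  test.\<close>

lemma nijenhuis_vec:
  assumes "Vector_Spaces.linear scale scale N" "N e1 = vec a b" "N e2 = vec c d"
  shows "N (vec u v) = vec (u * a + v * c) (u * b + v * d)"
    and "N 0 = 0"
    and "nijenhuis_operator scale mult N \<longleftrightarrow>
    (\<forall>x\<in>{vec 1 0, vec 0 1}. \<forall>y\<in>{vec 1 0, vec 0 1}.
      mult (N x) (N y) = N (mult (N x) y + mult x (N y) - N (mult x y)))"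
  using assms module_hom.zero[OF module_hom_linearI[OF assms(1)]]
  by (simp_all only: nijenhuis_on_basis vec_basis linear_vec vec_arith)

section \<open>The six algebras\<close>

lemma algebra_B1:
  assumes tab: "product_table mult e1 e2 (vec 0 0) (vec 0 0) (vec (-1) 0) (vec 1 (-1))"
  shows "pre_lie_algebra scale mult" "non_commutative mult"
    "Vector_Spaces.linear scale scale N \<Longrightarrow> nijenhuis_operator scale mult N \<longleftrightarrow>
      (\<exists>n11 n21. N e1 = vec n11 0 \<and> N e2 = vec n21 n11)"
proof -
  note mult = mult_vec[OF tab]
  show "pre_lie_algebra scale mult"
    by (rule pre_lie_vec[OF tab]) (auto simp: mult vec_arith vec_eq_iff algebra_simps)
  show "non_commutative mult"
    by (rule non_commutative_vec[OF tab]) simp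
  assume N: "Vector_Spaces.linear scale scale N"
  obtain a b c d where ab: "N e1 = vec a b" and cd: "N e2 = vec c d"
    by (meson vec_cases)
  note nijenhuis = nijenhuis_vec(3)[OF N ab cd]
    and coords = ab cd nijenhuis_vec(1,2)[OF N ab cd] mult vec_arith vec_eq_iff vec_eq_0_iff
  have "nijenhuis_operator scale mult N \<longleftrightarrow>
      b = 0 \<and> d = a" (is "?L \<longleftrightarrow> ?R")
  proof
    assume ?L
    \<comment> \<open>These are the \<open>e1\<close>-coordinates of the pairs
      \<open>(e1, e1)\<close> and \<open>(e2, e2)\<close>. The second equation is computed for
      \<open>b = 0\<close>, hence the escape \<open>b \<noteq> 0\<close>, which the first one rules
      out. The double root leaves \<open>c\<close> free.\<close>
    then have "b\<^sup>2 = 0" "(d - a)\<^sup>2 = 0 \<or> b \<noteq> 0"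
      unfolding nijenhuis by (auto simp: coords power2_eq_square algebra_simps)
    then show ?R
      by simp
  next
    assume ?R
    then show ?L
      unfolding nijenhuis by (simp add: coords algebra_simps)
  qed
  then show "nijenhuis_operator scale mult N \<longleftrightarrow>
      (\<exists>n11 n21. N e1 = vec n11 0 \<and> N e2 = vec n21 n11)"
    by (simp add: ab cd vec_eq_iff)
qed

text \<open>With f the \<open>e2\<close>-coordinate, the product is x.y = -f(x) y. For every linear
  \<open>N\<close> the last two terms on the right of the Nijenhuis identity cancel, and both sides
  are -f(N x) N y.\<close>

lemma algebra_B2:
  assumes tab: "product_table mult e1 e2 (vec 0 0) (vec 0 0) (vec (-1) 0) (vec 0 (-1))"
  shows "pre_lie_algebra scale mult" "non_commutative mult"
    "Vector_Spaces.linear scale scale N \<Longrightarrow> nijenhuis_operator scale mult N \<longleftrightarrow>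
      (\<exists>n11 n12 n21 n22. N e1 = vec n11 n12 \<and> N e2 = vec n21 n22)"
proof -
  note mult = mult_vec[OF tab]
  show "pre_lie_algebra scale mult"
    by (rule pre_lie_vec[OF tab]) (auto simp: mult vec_arith vec_eq_iff algebra_simps)
  show "non_commutative mult"
    by (rule non_commutative_vec[OF tab]) simp
  assume N: "Vector_Spaces.linear scale scale N"
  obtain a b c d where ab: "N e1 = vec a b" and cd: "N e2 = vec c d"
    by (meson vec_cases)
  note nijenhuis = nijenhuis_vec(3)[OF N ab cd]
    and coords = ab cd nijenhuis_vec(1,2)[OF N ab cd] mult vec_arith vec_eq_iff vec_eq_0_iff
  show "nijenhuis_operator scale mult N \<longleftrightarrow>
      (\<exists>n11 n12 n21 n22. N e1 = vec n11 n12 \<and> N e2 = vec n21 n22)"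
    unfolding nijenhuis by (simp add: coords algebra_simps)
qed

text \<open>The conditions carry the factor \<open>k + 1\<close>; at \<open>k = -1\<close> the table
  is that of \<open>B2\<close>, where every linear map qualifies. Requiring
  \<open>n21 \<noteq> 0\<close> keeps the two families disjoint.\<close>

lemma algebra_B3:
  assumes tab: "product_table mult e1 e2 (vec 0 0) (vec 0 0) (vec (-1) 0) (vec 0 k)"
    and k: "k \<noteq> -1"
  shows "pre_lie_algebra scale mult" "non_commutative mult"
    "Vector_Spaces.linear scale scale N \<Longrightarrow> nijenhuis_operator scale mult N \<longleftrightarrow>
      (\<exists>n11 n21. n21 \<noteq> 0 \<and> N e1 = vec n11 0 \<and> N e2 = vec n21 n11) \<or>
      (\<exists>n11 n22. N e1 = vec n11 0 \<and> N e2 = vec 0 n22)"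
proof -
  note mult = mult_vec[OF tab]
  show "pre_lie_algebra scale mult"
    by (rule pre_lie_vec[OF tab]) (auto simp: mult vec_arith vec_eq_iff algebra_simps)
  show "non_commutative mult"
    by (rule non_commutative_vec[OF tab]) simp
  assume N: "Vector_Spaces.linear scale scale N"
  obtain a b c d where ab: "N e1 = vec a b" and cd: "N e2 = vec c d"
    by (meson vec_cases)
  note nijenhuis = nijenhuis_vec(3)[OF N ab cd]
    and coords = ab cd nijenhuis_vec(1,2)[OF N ab cd] mult vec_arith vec_eq_iff vec_eq_0_iff
  have "nijenhuis_operator scale mult N \<longleftrightarrow>
      b = 0 \<and> (c = 0 \<or> a = d)" (is "?L \<longleftrightarrow> ?R")
  proof
    assume ?L
    then have "(k + 1) * b\<^sup>2 = 0" "(k + 1) * c * (a - d) = 0 \<or> b \<noteq> 0"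
      unfolding nijenhuis by (auto simp: coords power2_eq_square algebra_simps)
    moreover have "k + 1 \<noteq> 0"
      using k by (simp add: add_eq_0_iff2)
    ultimately show ?R
      by auto
  next
    assume ?R
    then show ?L
      unfolding nijenhuis by (auto simp: coords algebra_simps)
  qed
  then show "nijenhuis_operator scale mult N \<longleftrightarrow>
      (\<exists>n11 n21. n21 \<noteq> 0 \<and> N e1 = vec n11 0 \<and> N e2 = vec n21 n11) \<or>
      (\<exists>n11 n22. N e1 = vec n11 0 \<and> N e2 = vec 0 n22)"
    by (auto simp: ab cd vec_eq_iff)
qed

text \<open>Mirror image of \<open>B2\<close>: the product is x.y = f(y) x with f the
  \<open>e2\<close>-coordinate, and both sides of the Nijenhuis identity reduce to f(N y) N
  x.\<close>

lemma algebra_B4: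
  assumes tab: "product_table mult e1 e2 (vec 0 0) (vec 1 0) (vec 0 0) (vec 0 1)"
  shows "pre_lie_algebra scale mult" "non_commutative mult"
    "Vector_Spaces.linear scale scale N \<Longrightarrow> nijenhuis_operator scale mult N \<longleftrightarrow>
      (\<exists>n11 n12 n21 n22. N e1 = vec n11 n12 \<and> N e2 = vec n21 n22)"
proof -
  note mult = mult_vec[OF tab]
  show "pre_lie_algebra scale mult"
    by (rule pre_lie_vec[OF tab]) (auto simp: mult vec_arith vec_eq_iff algebra_simps)
  show "non_commutative mult"
    by (rule non_commutative_vec[OF tab]) simp
  assume N: "Vector_Spaces.linear scale scale N"
  obtain a b c d where ab: "N e1 = vec a b" and cd: "N e2 = vec c d"
    by (meson vec_cases)
  note nijenhuis = nijenhuis_vec(3)[OF N ab cd]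
    and coords = ab cd nijenhuis_vec(1,2)[OF N ab cd] mult vec_arith vec_eq_iff vec_eq_0_iff
  show "nijenhuis_operator scale mult N \<longleftrightarrow>
      (\<exists>n11 n12 n21 n22. N e1 = vec n11 n12 \<and> N e2 = vec n21 n22)"
    unfolding nijenhuis by (simp add: coords algebra_simps)
qed

lemma algebra_B5:
  assumes tab: "product_table mult e1 e2 (vec 0 0) (vec l 0) (vec (l - 1) 0) (vec 1 l)"
  shows "pre_lie_algebra scale mult" "non_commutative mult"
    "Vector_Spaces.linear scale scale N \<Longrightarrow> nijenhuis_operator scale mult N \<longleftrightarrow>
      (\<exists>n11 n21. N e1 = vec n11 0 \<and> N e2 = vec n21 n11) \<or>
      (l \<noteq> 1 \<and> (\<exists>n11 n22. n11 \<noteq> n22 \<and>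
        N e1 = vec n11 0 \<and> N e2 = vec ((n11 - n22) / (l - 1)) n22))"
proof -
  note mult = mult_vec[OF tab]
  show "pre_lie_algebra scale mult"
    by (rule pre_lie_vec[OF tab]) (auto simp: mult vec_arith vec_eq_iff algebra_simps)
  show "non_commutative mult"
    by (rule non_commutative_vec[OF tab]) simp
  assume N: "Vector_Spaces.linear scale scale N"
  obtain a b c d where ab: "N e1 = vec a b" and cd: "N e2 = vec c d"
    by (meson vec_cases)
  note nijenhuis = nijenhuis_vec(3)[OF N ab cd]
    and coords = ab cd nijenhuis_vec(1,2)[OF N ab cd] mult vec_arith vec_eq_iff vec_eq_0_iff
  have "nijenhuis_operator scale mult N \<longleftrightarrow>
      b = 0 \<and> (a - d) * (a - (d + (l - 1) * c)) = 0" (is "?L \<longleftrightarrow> ?R")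
  proof
    assume ?L
    then have "b\<^sup>2 = 0" "(a - d) * (a - (d + (l - 1) * c)) = 0 \<or> b \<noteq> 0"
      unfolding nijenhuis by (auto simp: coords power2_eq_square algebra_simps)
    then show ?R
      by simp
  next
    assume ?R
    then show ?L
      unfolding nijenhuis by (auto simp: coords algebra_simps)
  qed
  \<comment> \<open>The second factor is solved for \<open>c\<close>. At \<open>l = 1\<close> it
    coincides with the first factor, so the second family disappears; for other \<open>l\<close> the
    overlap \<open>a = d\<close> is counted in the first family.\<close>
  moreover have slope: "a - (d + (l - 1) * c) = 0 \<longleftrightarrow>
      (if l = 1 then a = d else c = (a - d) / (l - 1))"
    by (simp add: eq_divide_eq) (auto simp: algebra_simps)
  ultimately show "nijenhuis_operator scale mult N \<longleftrightarrow>
      (\<exists>n11 n21. N e1 = vec n11 0 \<and> N e2 = vec n21 n11) \<or>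
      (l \<noteq> 1 \<and> (\<exists>n11 n22. n11 \<noteq> n22 \<and>
        N e1 = vec n11 0 \<and> N e2 = vec ((n11 - n22) / (l - 1)) n22))"
    unfolding mult_eq_0_iff slope by (auto simp: ab cd vec_eq_iff)
qed

lemma algebra_B6:
  assumes tab: "product_table mult e1 e2 (vec 2 0) (vec 0 1) (vec 0 0) (vec 1 0)"
  shows "pre_lie_algebra scale mult" "non_commutative mult"
    "Vector_Spaces.linear scale scale N \<Longrightarrow> nijenhuis_operator scale mult N \<longleftrightarrow>
      (\<exists>n11 n21 s. (s = 1 \<or> s = -1) \<and>
        N e1 = vec n11 0 \<and> N e2 = vec n21 (n11 + s * n21 * \<i>)) \<or>
      (\<exists>n11 n12. n12 \<noteq> 0 \<and> N e1 = vec n11 n12 \<and> N e2 = vec (- n12) n11)"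
proof -
  note mult = mult_vec[OF tab]
  show "pre_lie_algebra scale mult"
    by (rule pre_lie_vec[OF tab]) (auto simp: mult vec_arith vec_eq_iff algebra_simps)
  show "non_commutative mult"
    by (rule non_commutative_vec[OF tab]) simp
  assume N: "Vector_Spaces.linear scale scale N"
  obtain a b c d where ab: "N e1 = vec a b" and cd: "N e2 = vec c d"
    by (meson vec_cases)
  note nijenhuis = nijenhuis_vec(3)[OF N ab cd]
    and coords = ab cd nijenhuis_vec(1,2)[OF N ab cd] mult vec_arith vec_eq_iff vec_eq_0_iff
  \<comment> \<open>The pair \<open>(e2, e2)\<close> with \<open>b = 0\<close> gives
    \<open>(d - a)\<^sup>2 = - c\<^sup>2\<close>. The right side is written as the square of
    \<open>\<i> * c\<close> so that the equation splits into two signs.\<close>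
  have "nijenhuis_operator scale mult N \<longleftrightarrow>
      (b = 0 \<and> (d - a)\<^sup>2 = (\<i> * c)\<^sup>2) \<or> (b \<noteq> 0 \<and> d = a \<and> c = - b)" (is "?L \<longleftrightarrow> ?R")
  proof
    assume ?L
    \<comment> \<open>The first two equations are the coordinates of the pair
      \<open>(e1, e1)\<close>. For nonzero \<open>b\<close> they already fix \<open>c\<close> and
      \<open>d\<close>.\<close>
    then have "b * (a - d) = 0" "b * (b + c) = 0" "(d - a)\<^sup>2 = (\<i> * c)\<^sup>2 \<or> b \<noteq> 0"
      unfolding nijenhuis by (auto simp: coords power2_eq_square algebra_simps)
    then show ?R
      by (auto simp: add_eq_0_iff2)
  next
    assume ?R
    then show ?L
      unfolding nijenhuis by (auto simp: coords power2_eq_square algebra_simps)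
  qed
  then show "nijenhuis_operator scale mult N \<longleftrightarrow>
      (\<exists>n11 n21 s. (s = 1 \<or> s = -1) \<and>
        N e1 = vec n11 0 \<and> N e2 = vec n21 (n11 + s * n21 * \<i>)) \<or>
      (\<exists>n11 n12. n12 \<noteq> 0 \<and> N e1 = vec n11 n12 \<and> N e2 = vec (- n12) n11)"
    \<comment> \<open>The two square roots correspond to \<open>s = 1\<close> and
      \<open>s = -1\<close>, with \<open>n21 = c\<close>.\<close>
    unfolding power2_eq_iff by (auto simp: ab cd vec_eq_iff algebra_simps)
qed

end

section \<open>The classification for all six tables\<close>

theorem theorem3p2:
  fixes scale :: "complex \<Rightarrow> 'a::ab_group_add \<Rightarrow> 'a" (infixr "*s" 75)
    and mult :: "'a \<Rightarrow> 'a \<Rightarrow> 'a"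
    and e1 e2 :: 'a
  assumes "vector_space scale"
    and "two_dim_basis scale e1 e2"
    and "bilinear_product scale mult"
  shows
    "(product_table mult e1 e2 0 0 (- e1) (e1 - e2) \<longrightarrow>
      pre_lie_algebra scale mult \<and> non_commutative mult \<and>
      (\<forall>N. Vector_Spaces.linear scale scale N \<longrightarrow>
        (nijenhuis_operator scale mult N \<longleftrightarrow>
          (\<exists>n11 n21. N e1 = n11 *s e1 \<and> N e2 = n21 *s e1 + n11 *s e2)))) \<and>
     (product_table mult e1 e2 0 0 (- e1) (- e2) \<longrightarrow>
      pre_lie_algebra scale mult \<and> non_commutative mult \<and>
      (\<forall>N. Vector_Spaces.linear scale scale N \<longrightarrow>
        (nijenhuis_operator scale mult N \<longleftrightarrow>
          (\<exists>n11 n12 n21 n22. N e1 = n11 *s e1 + n12 *s e2 \<and> N e2 = n21 *s e1 + n22 *s e2)))) \<and>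
     (\<forall>k. k \<noteq> -1 \<longrightarrow> product_table mult e1 e2 0 0 (- e1) (k *s e2) \<longrightarrow>
      pre_lie_algebra scale mult \<and> non_commutative mult \<and>
      (\<forall>N. Vector_Spaces.linear scale scale N \<longrightarrow>
        (nijenhuis_operator scale mult N \<longleftrightarrow>
          (\<exists>n11 n21. n21 \<noteq> 0 \<and> N e1 = n11 *s e1 \<and> N e2 = n21 *s e1 + n11 *s e2) \<or>
          (\<exists>n11 n22. N e1 = n11 *s e1 \<and> N e2 = n22 *s e2)))) \<and>
     (product_table mult e1 e2 0 e1 0 e2 \<longrightarrow>
      pre_lie_algebra scale mult \<and> non_commutative mult \<and>
      (\<forall>N. Vector_Spaces.linear scale scale N \<longrightarrow>
        (nijenhuis_operator scale mult N \<longleftrightarrow>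
          (\<exists>n11 n12 n21 n22. N e1 = n11 *s e1 + n12 *s e2 \<and> N e2 = n21 *s e1 + n22 *s e2)))) \<and>
     (\<forall>l. l \<noteq> 0 \<longrightarrow> product_table mult e1 e2 0 (l *s e1) ((l - 1) *s e1) (e1 + l *s e2) \<longrightarrow>
      pre_lie_algebra scale mult \<and> non_commutative mult \<and>
      (\<forall>N. Vector_Spaces.linear scale scale N \<longrightarrow>
        (nijenhuis_operator scale mult N \<longleftrightarrow>
          (\<exists>n11 n21. N e1 = n11 *s e1 \<and> N e2 = n21 *s e1 + n11 *s e2) \<or>
          (l \<noteq> 1 \<and> (\<exists>n11 n22. n11 \<noteq> n22 \<and>
            N e1 = n11 *s e1 \<and> N e2 = ((n11 - n22) / (l - 1)) *s e1 + n22 *s e2))))) \<and>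
     (product_table mult e1 e2 (2 *s e1) e2 0 e1 \<longrightarrow>
      pre_lie_algebra scale mult \<and> non_commutative mult \<and>
      (\<forall>N. Vector_Spaces.linear scale scale N \<longrightarrow>
        (nijenhuis_operator scale mult N \<longleftrightarrow>
          (\<exists>n11 n21 s. (s = 1 \<or> s = -1) \<and>
            N e1 = n11 *s e1 \<and> N e2 = n21 *s e1 + (n11 + s * n21 * \<i>) *s e2) \<or>
          (\<exists>n11 n12. n12 \<noteq> 0 \<and>
            N e1 = n11 *s e1 + n12 *s e2 \<and> N e2 = (- n12) *s e1 + n11 *s e2))))"
proof -
  interpret plane_algebra scale mult e1 e2
    using assms by (simp add: plane_algebra_def plane_algebra_axioms_def)
  show ?thesis
    \<comment> \<open>Unfolding \<open>vec\<close> removes zero and unit coefficients, which turns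
      the coordinate tables and families into the stated ones.\<close>
    using algebra_B1 algebra_B2 algebra_B3 algebra_B4 algebra_B5 algebra_B6
    by (simp add: vec_def)
qed

end
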